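(* There exist constants $0<c_1,c_2<\infty$ such that, for all $n\in\{1,2,3,\ldots\}\cup\{\infty\}$, $$\theta(p)\leq\theta(p,n)\leq c_1\,\theta(p)\quad\text{for } p\in(p_c^*,1],$$ $$\tau_p(x)\leq\tau_{p,n}(x)\leq p^{-c_2}\,\tau_p(x)\quad\text{for } p\in(0,p_c^*] \text{ and } x\in\mathbb{Z}^2,$$ $$\xi(p,n)=\xi(p)\quad\text{for } p\in(0,p_c^*].$$ (The last equality is understood as: if the limit defining $\xi(p)^{-1}$ exists, then so does the limit defining $\xi(p,n)^{-1}$, and the two are equal.)
   Context: Two sites of $\mathbb{Z}^2$ are neighbors if they are at Euclidean distance $1$. The initial configuration $\omega=\omega_0\in\{0,1\}^{\mathbb{Z}^2}$ is chosen according to $P_p$, the product of Bernoulli measures with parameter $p$ (each site is independently $1$ with probability $p$). The bootstrap dynamics is deterministic, in discrete time, with simultaneous updates: $1$'s remain $1$ forever, and a $0$ becomes $1$ at the next update if and only if it has at least three neighbors (out of four) that are $1$. $\omega_n$ is the configuration after $n$ updates and $\omega_\infty=\bar\omega=\lim_n\omega_n$ is the final (bootstrapped) configuration (the limit exists by monotonicity). Sites with value $1$ are called open. $\mathbb{Z}^2_{cp}$ is the close-packed version of $\mathbb{Z}^2$, obtained by adding the two diagonals to each face of $\mathbb{Z}^2$ (so each site has eight neighbors, called $*$-neighbors). $p_c^*$ is the critical value of independent site percolation on $\mathbb{Z}^2_{cp}$; it equals $1-p_c$, where $p_c$ is the critical value of independent site percolation on $\mathbb{Z}^2$. Open clusters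 here are connected components of open sites in $\mathbb{Z}^2_{cp}$. For independent site percolation on $\mathbb{Z}^2_{cp}$ (i.e. for $\omega_0$): with $C_o$ the open cluster containing the origin $o$, $\theta(p)=P_p(|C_o|=\infty)$ is the percolation probability; $\tau_p(x)=P_p(o\text{ and }x\text{ belong to the same open cluster})$ is the connectivity function; the correlation length $\xi(p)\in(0,\infty]$ is defined by $\xi(p)^{-1}=\lim_{\|x\|\to\infty}\left\{-\frac{1}{\|x\|}\log\tau_p(x)\right\}$, where $\|x\|$ is the Euclidean norm. $\theta(p,n)$, $\tau_{p,n}(x)$, $\xi(p,n)$ denote the same quantities defined with the configuration $\omega_n$ in place of $\omega_0$ (again with open clusters in $\mathbb{Z}^2_{cp}$), $n=\infty$ corresponding to $\bar\omega$. *)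

theory Defs
  imports "HOL-Probability.Probability"
begin

type_synonym site = "int \<times> int"
type_synonym config = "site \<Rightarrow> bool"

definition site_norm :: "site \<Rightarrow> real" where
  "site_norm x = sqrt ((real_of_int (fst x))\<^sup>2 + (real_of_int (snd x))\<^sup>2)"

definition nbr :: "site \<Rightarrow> site \<Rightarrow> bool" where
  "nbr x y \<longleftrightarrow> site_norm (x - y) = 1"

definition star_nbr :: "site \<Rightarrow> site \<Rightarrow> bool" where
  "star_nbr x y \<longleftrightarrow> nbr x y \<or> (\<bar>fst x - fst y\<bar> = 1 \<and> \<bar>snd x - snd y\<bar> = 1)"

definition bernoulli_product :: "real \<Rightarrow> config measure" where
  "bernoulli_product p = (\<Pi>\<^sub>M x\<in>UNIV. measure_pmf (bernoulli_pmf p))"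

definition boot_step :: "config \<Rightarrow> config" where
  "boot_step \<omega> x \<longleftrightarrow> \<omega> x \<or> 3 \<le> card {y. nbr x y \<and> \<omega> y}"

text \<open>By monotonicity in time, the pointwise limit of the iterates is 1 at a site iff some
  iterate is; see \<open>bootstrap_infinity_limit\<close>.\<close>

fun bootstrap :: "enat \<Rightarrow> config \<Rightarrow> config" where
  "bootstrap (enat n) \<omega> = (boot_step ^^ n) \<omega>"
| "bootstrap \<infinity> \<omega> = (\<lambda>x. \<exists>n. (boot_step ^^ n) \<omega> x)"

lemma bootstrap_0 [simp]: "bootstrap 0 \<omega> = \<omega>"
  by (simp add: zero_enat_def)

lemma boot_step_funpow_mono:
  assumes "m \<le> n" and "(boot_step ^^ m) \<omega> x"
  shows "(boot_step ^^ n) \<omega> x"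
  using assms by (induction n rule: dec_induct) (auto simp: boot_step_def)

lemma bootstrap_infinity_limit:
  "\<forall>\<^sub>F n in sequentially. bootstrap (enat n) \<omega> x = bootstrap \<infinity> \<omega> x"
proof (cases "\<exists>m. (boot_step ^^ m) \<omega> x")
  case True
  then obtain m where "(boot_step ^^ m) \<omega> x" ..
  with True show ?thesis
    unfolding eventually_sequentially
    by (intro exI[of _ m]) (metis bootstrap.simps boot_step_funpow_mono)
qed auto

text \<open>The cluster of a closed site is empty.\<close>

definition open_cluster :: "config \<Rightarrow> site \<Rightarrow> site set" where
  "open_cluster \<omega> x = {y. \<omega> x \<and> (\<lambda>u v. star_nbr u v \<and> \<omega> u \<and> \<omega> v)\<^sup>*\<^sup>* x y}"

text \<open>Time \<open>n = 0\<close> gives the quantities for independent site percolation.\<close>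

definition theta :: "real \<Rightarrow> enat \<Rightarrow> real" where
  "theta p n = \<P>(\<omega> in bernoulli_product p. infinite (open_cluster (bootstrap n \<omega>) 0))"

definition tau :: "real \<Rightarrow> enat \<Rightarrow> site \<Rightarrow> real" where
  "tau p n x = \<P>(\<omega> in bernoulli_product p. x \<in> open_cluster (bootstrap n \<omega>) 0)"

definition pc_star :: real where
  "pc_star = Sup {p \<in> {0..1}. theta p 0 = 0}"

definition decay_rate :: "real \<Rightarrow> enat \<Rightarrow> site \<Rightarrow> real" where
  "decay_rate p n x = - (1 / site_norm x) * ln (tau p n x)"

definition sites_at_infinity :: "site filter" where
  "sites_at_infinity = filtercomap site_norm at_top"

definition corr_length_exists :: "real \<Rightarrow> enat \<Rightarrow> bool" where
  "corr_length_exists p n \<longleftrightarrow> (\<exists>L. (decay_rate p n \<longlongrightarrow> L) sites_at_infinity)"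

text \<open>The inverse is taken in \<open>ereal\<close>, where \<open>inverse 0 = \<infinity>\<close>. The value is meaningful only
  under \<open>corr_length_exists\<close>.\<close>

definition corr_length :: "real \<Rightarrow> enat \<Rightarrow> ereal" where
  "corr_length p n = inverse (ereal (Lim sites_at_infinity (decay_rate p n)))"

end

theory Submission
  imports Defs
begin

text \<open>
  The bootstrap rule never merges two open \<open>*\<close>-clusters. Of the eight sites around a site that
  opens, those already open are connected to each other without it, because three open nearest
  neighbors cover the whole ring; and two \<open>*\<close>-adjacent sites that open together have an open
  site in both rings. Hence two sites open in \<open>\<omega>\<close> are connected in \<open>\<omega>\<^sub>n\<close> only if they
  are connected in \<open>\<omega>\<close> (\<open>linked_bootstrap\<close>). Moreover a closed 2-by-2 square stays closed
  forever, so every open site of \<open>\<omega>\<^sub>n\<close> has, within \<open>*\<close>-distance one, an open site of \<open>\<omega>\<close>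
  (\<open>bootstrap_open_square\<close>), and each cluster of \<open>\<omega>\<^sub>n\<close> lies in the 1-neighborhood of
  a single cluster of \<open>\<omega>\<close>.

  For the percolation probability, an infinite cluster of \<open>\<omega>\<^sub>n\<close> at the origin therefore forces
  an infinite cluster of \<open>\<omega>\<close> at one of the four sites of a square; by translation invariance
  the constant 4 works.

  For the connectivity function, suppose that the origin and \<open>x\<close> are connected in \<open>\<omega>\<^sub>n\<close>.
  After both are opened by hand in \<open>\<omega>\<close>, they are still connected at time \<open>n\<close>, by
  monotonicity, and being open from the start they are connected at time 0. Opening one site by
  hand costs at most a factor \<open>1 / p\<close> in probability (\<open>prob_force_open_le\<close>), so the
  exponent 2 works. The logarithms of the two connectivity functions then differ by at most
  \<open>- 2 * ln p\<close>, which is negligible against \<open>site_norm x\<close>, and the two correlation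
  lengths agree.
\<close>

section \<open>Bootstrap steps and open clusters\<close>

lemma nbr_iff: "nbr (a, b) (c, d) \<longleftrightarrow> \<bar>a - c\<bar> + \<bar>b - d\<bar> = 1"
proof -
  have unit: "x\<^sup>2 + y\<^sup>2 = 1 \<longleftrightarrow> x + y = 1" if "0 \<le> x" "0 \<le> y" for x y :: int
  proof
    assume eq: "x\<^sup>2 + y\<^sup>2 = 1"
    have "t \<le> t\<^sup>2" if "0 \<le> t" for t :: int
      using that by (cases "t = 0") (auto intro!: self_le_power)
    from this[of x] this[of y] eq that have "x \<le> 1" "y \<le> 1"
      using zero_le_power2[of x] zero_le_power2[of y] by linarith+
    with that have "x \<in> {0, 1}" "y \<in> {0, 1}" by auto
    with eq show "x + y = 1" by auto
  next
    assume "x + y = 1"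
    with that have "(x = 0 \<and> y = 1) \<or> (x = 1 \<and> y = 0)" by linarith
    then show "x\<^sup>2 + y\<^sup>2 = 1" by auto
  qed
  have "nbr (a, b) (c, d) \<longleftrightarrow> real_of_int ((a - c)\<^sup>2 + (b - d)\<^sup>2) = 1"
    by (simp add: nbr_def site_norm_def)
  also have "\<dots> \<longleftrightarrow> \<bar>a - c\<bar>\<^sup>2 + \<bar>b - d\<bar>\<^sup>2 = 1"
    by (metis of_int_eq_1_iff power2_abs)
  also have "\<dots> \<longleftrightarrow> \<bar>a - c\<bar> + \<bar>b - d\<bar> = 1"
    by (rule unit) simp_all
  finally show ?thesis .
qed

lemma star_nbr_iff:
  "star_nbr (a, b) (c, d) \<longleftrightarrow> (a, b) \<noteq> (c, d) \<and> \<bar>a - c\<bar> \<le> 1 \<and> \<bar>b - d\<bar> \<le> 1"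
  unfolding star_nbr_def nbr_iff by auto

lemma star_nbr_cases:
  assumes "star_nbr (a, b) s"
  shows "s \<in> {(a + 1, b), (a - 1, b), (a, b + 1), (a, b - 1),
    (a + 1, b + 1), (a + 1, b - 1), (a - 1, b + 1), (a - 1, b - 1)}"
proof -
  obtain c d where s: "s = (c, d)" by fastforce
  have "(c = a + 1 \<or> c = a - 1 \<or> c = a) \<and> (d = b + 1 \<or> d = b - 1 \<or> d = b) \<and> (c \<noteq> a \<or> d \<noteq> b)"
    using assms by (auto simp: s star_nbr_iff)
  then show ?thesis by (auto simp: s)
qed

lemma star_nbr_commute: "star_nbr u v \<longleftrightarrow> star_nbr v u"
  by (cases u; cases v) (auto simp: star_nbr_iff)

lemma boot_step_iff:
  "boot_step \<omega> (a, b) \<longleftrightarrow> \<omega> (a, b) \<or>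
     (\<omega> (a + 1, b) \<and> \<omega> (a - 1, b) \<and> (\<omega> (a, b + 1) \<or> \<omega> (a, b - 1))) \<or>
     (\<omega> (a, b + 1) \<and> \<omega> (a, b - 1) \<and> (\<omega> (a + 1, b) \<or> \<omega> (a - 1, b)))"
proof -
  have nb: "{y. nbr (a, b) y \<and> \<omega> y} =
    {y \<in> {(a + 1, b), (a - 1, b), (a, b + 1), (a, b - 1)}. \<omega> y}"
    by (auto simp: nbr_iff)
  show ?thesis
    unfolding boot_step_def nb
    by (cases "\<omega> (a + 1, b)"; cases "\<omega> (a - 1, b)"; cases "\<omega> (a, b + 1)"; cases "\<omega> (a, b - 1)")
      (simp_all add: Collect_conj_eq Int_insert_left conj_disj_distribR Collect_disj_eq)
qed

abbreviation linked :: "config \<Rightarrow> site \<Rightarrow> site \<Rightarrow> bool" where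
  "linked \<omega> \<equiv> (\<lambda>u v. star_nbr u v \<and> \<omega> u \<and> \<omega> v)\<^sup>*\<^sup>*"

lemma mem_open_cluster: "y \<in> open_cluster \<omega> x \<longleftrightarrow> \<omega> x \<and> linked \<omega> x y"
  by (simp add: open_cluster_def)

lemma linked_sym: "linked \<omega> u v \<Longrightarrow> linked \<omega> v u"
  by (rule sympD[OF symp_rtranclp]) (auto simp: symp_def star_nbr_commute)

lemma linked_open: "linked \<omega> u v \<Longrightarrow> \<omega> u \<Longrightarrow> \<omega> v"
  by (induction rule: rtranclp_induct) auto

lemma linked_mono: "linked \<omega> u v \<Longrightarrow> \<omega> \<le> \<omega>' \<Longrightarrow> linked \<omega>' u v"
  by (erule rtranclp_mono[THEN predicate2D, rotated]) (auto simp: le_fun_def)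

definition open_patch :: "config \<Rightarrow> site \<Rightarrow> site set" where
  "open_patch \<omega> w = {r. \<omega> r \<and> (r = w \<or> star_nbr w r)}"

text \<open>If \<open>w\<close> has three open nearest neighbors, the middle one is a hub: the other two are
  \<open>*\<close>-adjacent to it, and each site around \<open>w\<close> is \<open>*\<close>-adjacent or equal to one of the
  three. If \<open>w\<close> is open already, it is its own hub.\<close>

lemma linked_open_patch_hub:
  assumes w: "boot_step \<omega> w"
  obtains m where "\<And>s. s \<in> open_patch \<omega> w \<Longrightarrow> linked \<omega> s m"
proof -
  have near: "linked \<omega> s m"
    if "\<omega> s" "\<omega> e" "\<omega> m" "\<omega> e'" "star_nbr e m" "star_nbr e' m"
      "s = m \<or> star_nbr s m \<or> star_nbr s e \<or> star_nbr s e'" for s e m e'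
    using that by (auto intro: rtranclp.rtrancl_into_rtrancl)
  note found = that
  obtain a b where ab: "w = (a, b)" by fastforce
  show thesis
  proof (cases "\<omega> w")
    case True
    then show thesis
      by (intro found[of w]) (auto simp: open_patch_def star_nbr_commute)
  next
    case False
    let ?E = "(a + 1, b)" and ?W = "(a - 1, b)" and ?N = "(a, b + 1)" and ?S = "(a, b - 1)"
    \<comment> \<open>\<open>m\<close> is the nearest neighbor opposite to the one that may be closed.\<close>
    have hub: thesis
      if T: "(e, m, e') \<in> {(?E, ?N, ?W), (?E, ?S, ?W), (?N, ?E, ?S), (?N, ?W, ?S)}"
        and "\<omega> e" "\<omega> m" "\<omega> e'" for e m e'
    proof (rule found)
      fix s assume "s \<in> open_patch \<omega> w"
      with False have s: "\<omega> s" "star_nbr w s" by (auto simp: open_patch_def)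
      have "star_nbr e m" "star_nbr e' m" using T by (auto simp: star_nbr_iff)
      moreover have "s = m \<or> star_nbr s m \<or> star_nbr s e \<or> star_nbr s e'"
        using star_nbr_cases[OF s(2)[unfolded ab]] T
        by (elim insertE emptyE; simp add: star_nbr_iff)
      ultimately show "linked \<omega> s m" using that s by (intro near[of s e m e']) auto
    qed
    have "(\<omega> ?E \<and> \<omega> ?N \<and> \<omega> ?W) \<or> (\<omega> ?E \<and> \<omega> ?S \<and> \<omega> ?W) \<or>
        (\<omega> ?N \<and> \<omega> ?E \<and> \<omega> ?S) \<or> (\<omega> ?N \<and> \<omega> ?W \<and> \<omega> ?S)"
      using w False unfolding ab boot_step_iff by argo
    then show thesis
      using hub[of ?E ?N ?W] hub[of ?E ?S ?W] hub[of ?N ?E ?S] hub[of ?N ?W ?S]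
      unfolding insert_iff by argo
  qed
qed

lemma linked_open_patch:
  assumes "boot_step \<omega> w" "r \<in> open_patch \<omega> w" "s \<in> open_patch \<omega> w"
  shows "linked \<omega> r s"
proof -
  obtain m where m: "\<And>s. s \<in> open_patch \<omega> w \<Longrightarrow> linked \<omega> s m"
    using linked_open_patch_hub[OF assms(1)] by blast
  show ?thesis by (rule rtranclp_trans[OF m[OF assms(2)] linked_sym[OF m[OF assms(3)]]])
qed

text \<open>The case that matters is when both sites are closed. Among the nearest neighbors of \<open>w\<close>
  at most one is closed, and two of them are \<open>*\<close>-adjacent to \<open>v\<close>: the two beside the edge
  for a horizontal or vertical pair, the two completing the square for a diagonal pair.\<close>

lemma open_patch_inter:
  assumes "boot_step \<omega> w" "star_nbr w v"
  shows "open_patch \<omega> w \<inter> open_patch \<omega> v \<noteq> {}"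
proof -
  obtain a b where ab: "w = (a, b)" by fastforce
  show ?thesis
  proof (cases "\<omega> w \<or> \<omega> v")
    case True
    then show ?thesis using assms(2) by (auto simp: open_patch_def star_nbr_commute)
  next
    case False
    let ?E = "(a + 1, b)" and ?W = "(a - 1, b)" and ?N = "(a, b + 1)" and ?S = "(a, b - 1)"
    have two: "\<omega> ?E \<or> \<omega> ?N" "\<omega> ?E \<or> \<omega> ?S" "\<omega> ?W \<or> \<omega> ?N" "\<omega> ?W \<or> \<omega> ?S"
      "\<omega> ?E \<or> \<omega> ?W" "\<omega> ?N \<or> \<omega> ?S"
      using assms(1) False unfolding ab boot_step_iff by argo+
    from star_nbr_cases[OF assms(2)[unfolded ab]]
    have "\<exists>r \<in> {?E, ?W, ?N, ?S}. \<omega> r \<and> star_nbr v r"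
      by (elim insertE emptyE) (use two in \<open>simp_all add: star_nbr_iff\<close>)
    then show ?thesis by (auto simp: open_patch_def ab star_nbr_iff)
  qed
qed

text \<open>One step merges no clusters. A path in the new configuration passes through patches that are
  linked internally and overlap consecutively; at a site open from the start the patch contains
  the site itself.\<close>

lemma linked_boot_step:
  assumes "linked (boot_step \<omega>) u v" "\<omega> u" "\<omega> v"
  shows "linked \<omega> u v"
proof -
  \<comment> \<open>The path may visit sites that are closed in \<open>\<omega>\<close>, so the induction follows whole
    patches.\<close>
  have "boot_step \<omega> v \<and> (\<forall>r \<in> open_patch \<omega> v. linked \<omega> u r)"
    using assms(1)
  proof (induction rule: rtranclp_induct)
    case base
    have "boot_step \<omega> u" using assms(2) by (simp add: boot_step_def)
    moreover have "u \<in> open_patch \<omega> u" using assms(2) by (simp add: open_patch_def)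
    ultimately show ?case using linked_open_patch by blast
  next
    case (step v v')
    then obtain r where r: "r \<in> open_patch \<omega> v" "r \<in> open_patch \<omega> v'"
      using open_patch_inter by blast
    have u: "linked \<omega> u r" using step.IH r(1) by blast
    have v': "boot_step \<omega> v'" using step.hyps by blast
    then show ?case using rtranclp_trans[OF u linked_open_patch[OF v' r(2)]] by blast
  qed
  moreover have "v \<in> open_patch \<omega> v" using assms(3) by (simp add: open_patch_def)
  ultimately show ?thesis by blast
qed

lemma linked_boot_step_funpow:
  assumes "linked ((boot_step ^^ n) \<omega>) u v" "\<omega> u" "\<omega> v"
  shows "linked \<omega> u v"
  using assms
proof (induction n)
  case (Suc n)
  have "(boot_step ^^ n) \<omega> u" "(boot_step ^^ n) \<omega> v"
    using Suc.prems boot_step_funpow_mono[of 0 n] by auto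
  with Suc show ?case using linked_boot_step by simp
qed simp

text \<open>A path is finite, so all its sites are open from some finite time on.\<close>

lemma linked_bootstrap_infinity:
  "linked (bootstrap \<infinity> \<omega>) u v \<Longrightarrow> \<exists>n. linked ((boot_step ^^ n) \<omega>) u v"
proof (induction rule: rtranclp_induct)
  case (step v v')
  then obtain n k l where
    n: "linked ((boot_step ^^ n) \<omega>) u v" and
    kl: "(boot_step ^^ k) \<omega> v" "(boot_step ^^ l) \<omega> v'" by auto
  define N where "N = max n (max k l)"
  then have N: "n \<le> N" "k \<le> N" "l \<le> N" by auto
  have "linked ((boot_step ^^ N) \<omega>) u v"
    by (rule linked_mono[OF n predicate1I]) (rule boot_step_funpow_mono[OF N(1)])
  moreover have "star_nbr v v' \<and> (boot_step ^^ N) \<omega> v \<and> (boot_step ^^ N) \<omega> v'"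
    using step.hyps boot_step_funpow_mono[OF N(2) kl(1)] boot_step_funpow_mono[OF N(3) kl(2)]
    by blast
  ultimately have "linked ((boot_step ^^ N) \<omega>) u v'" by (rule rtranclp.rtrancl_into_rtrancl)
  then show ?case ..
qed auto

lemma linked_bootstrap:
  assumes "linked (bootstrap n \<omega>) u v" "\<omega> u" "\<omega> v"
  shows "linked \<omega> u v"
proof (cases n)
  case (enat k)
  then show ?thesis using assms linked_boot_step_funpow by simp
next
  case infinity
  then obtain k where "linked ((boot_step ^^ k) \<omega>) u v"
    using assms(1) linked_bootstrap_infinity by blast
  then show ?thesis using assms(2,3) by (rule linked_boot_step_funpow)
qed

lemma bootstrap_increasing: "\<omega> \<le> bootstrap n \<omega>"
proof (cases n)
  case (enat k)
  then show ?thesis using boot_step_funpow_mono[of 0 k] by auto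
next
  case infinity
  then show ?thesis by (auto simp: le_fun_def intro: exI[of _ 0])
qed

lemma boot_step_mono: "\<omega> \<le> \<omega>' \<Longrightarrow> boot_step \<omega> \<le> boot_step \<omega>'"
  by (auto simp: le_fun_def boot_step_iff)

lemma bootstrap_mono:
  assumes "\<omega> \<le> \<omega>'"
  shows "bootstrap n \<omega> \<le> bootstrap n \<omega>'"
proof -
  have step: "(boot_step ^^ k) \<omega> \<le> (boot_step ^^ k) \<omega>'" for k
    by (rule funpow_mono) (auto simp: mono_def boot_step_mono assms)
  then show ?thesis by (cases n) (auto simp: le_fun_def)
qed

lemma open_cluster_mono: "\<omega> \<le> \<omega>' \<Longrightarrow> open_cluster \<omega> x \<subseteq> open_cluster \<omega>' x"
  by (auto simp: mem_open_cluster intro: linked_mono dest: predicate1D)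

text \<open>In a closed 2-by-2 square each site has two closed nearest neighbors, one more than the rule
  tolerates, so the square stays closed at every step. The square with \<open>(a, b)\<close> as its lower
  left corner is an arbitrary choice among the four that contain \<open>(a, b)\<close>.\<close>

lemma bootstrap_open_square:
  assumes "bootstrap n \<omega> (a, b)"
  shows "\<omega> (a, b) \<or> \<omega> (a + 1, b) \<or> \<omega> (a, b + 1) \<or> \<omega> (a + 1, b + 1)"
proof -
  obtain k where "(boot_step ^^ k) \<omega> (a, b)"
    using assms by (cases n) auto
  then have "\<exists>s \<in> {(a, b), (a + 1, b), (a, b + 1), (a + 1, b + 1)}. (boot_step ^^ k) \<omega> s"
    by blast
  then show ?thesis
  proof (induction k)
    case (Suc k)
    then show ?case by (auto simp: boot_step_iff)
  qed auto
qed

text \<open>Each site of the late cluster has an initially open site in its square, and all those sites lie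
  in one initial cluster. That correspondence is at most four-to-one, so the initial cluster is
  infinite as well.\<close>

lemma infinite_open_cluster_bootstrap:
  assumes inf: "infinite (open_cluster (bootstrap n \<omega>) (a, b))"
  shows "\<exists>y \<in> {(a, b), (a + 1, b), (a, b + 1), (a + 1, b + 1)}. infinite (open_cluster \<omega> y)"
proof -
  define sq :: "site \<Rightarrow> site set" where
    "sq = (\<lambda>(i, j). {(i, j), (i + 1, j), (i, j + 1), (i + 1, j + 1)})"
  have sq: "\<exists>r \<in> sq w. \<omega> r \<and> linked (bootstrap n \<omega>) w r" if w: "bootstrap n \<omega> w" for w
  proof -
    obtain i j where ij: "w = (i, j)" by fastforce
    obtain r where r: "r \<in> sq w" "\<omega> r"
      using bootstrap_open_square[of n \<omega> i j] w by (auto simp: ij sq_def)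
    then have "bootstrap n \<omega> r" using predicate1D[OF bootstrap_increasing] by blast
    moreover have "r = w \<or> star_nbr w r" using r by (auto simp: ij sq_def star_nbr_iff)
    ultimately have "linked (bootstrap n \<omega>) w r" using w by auto
    then show ?thesis using r by blast
  qed
  have "open_cluster (bootstrap n \<omega>) (a, b) \<noteq> {}" using inf by auto
  then have open0: "bootstrap n \<omega> (a, b)" by (auto simp: mem_open_cluster)
  obtain y where y: "y \<in> sq (a, b)" "\<omega> y" "linked (bootstrap n \<omega>) (a, b) y" using sq[OF open0] by blast
  \<comment> \<open>The sites whose square contains the given one.\<close>
  define anchors :: "site \<Rightarrow> site set" where
    "anchors = (\<lambda>(i, j). {(i, j), (i - 1, j), (i, j - 1), (i - 1, j - 1)})"
  have "open_cluster (bootstrap n \<omega>) (a, b) \<subseteq> (\<Union>r \<in> open_cluster \<omega> y. anchors r)"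
  proof
    fix u assume "u \<in> open_cluster (bootstrap n \<omega>) (a, b)"
    then have u: "linked (bootstrap n \<omega>) (a, b) u" by (simp add: mem_open_cluster)
    obtain r where r: "r \<in> sq u" "\<omega> r" "linked (bootstrap n \<omega>) u r"
      using sq[OF linked_open[OF u open0]] by blast
    have "linked (bootstrap n \<omega>) y r"
      using linked_sym[OF y(3)] u r(3) by (meson rtranclp_trans)
    then have "linked \<omega> y r" using linked_bootstrap y(2) r(2) by blast
    moreover have "u \<in> anchors r" using r(1) by (cases u) (auto simp: sq_def anchors_def)
    ultimately show "u \<in> (\<Union>r \<in> open_cluster \<omega> y. anchors r)" using y(2) by (auto simp: mem_open_cluster)
  qed
  then have "infinite (\<Union>r \<in> open_cluster \<omega> y. anchors r)" using inf finite_subset by blast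
  then have "infinite (open_cluster \<omega> y)" by (rule contrapos_nn) (auto simp: anchors_def)
  then show ?thesis using y(1) by (auto simp: sq_def)
qed

abbreviation force_open :: "site \<Rightarrow> config \<Rightarrow> config" where
  "force_open x \<omega> \<equiv> fun_upd \<omega> x True"

text \<open>With both endpoints open at time 0, the absence of merging applies to them directly, which
  avoids any search for initially open sites nearby.\<close>

lemma open_cluster_bootstrap_force_open:
  assumes "x \<in> open_cluster (bootstrap n \<omega>) y"
  shows "x \<in> open_cluster (force_open x (force_open y \<omega>)) y"
proof -
  let ?\<omega>' = "force_open x (force_open y \<omega>)"
  have "open_cluster (bootstrap n \<omega>) y \<subseteq> open_cluster (bootstrap n ?\<omega>') y"
    by (intro open_cluster_mono bootstrap_mono) (auto simp: le_fun_def)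
  with assms have "linked (bootstrap n ?\<omega>') y x" by (auto simp: mem_open_cluster)
  then show ?thesis using linked_bootstrap[of n ?\<omega>' y x] by (simp add: mem_open_cluster)
qed

section \<open>Bernoulli product measures on site configurations\<close>

lemma prob_space_bernoulli_product: "prob_space (bernoulli_product p)"
  unfolding bernoulli_product_def by (intro prob_space_PiM prob_space_measure_pmf)

interpretation bernoulli_product: prob_space "bernoulli_product p" for p
  by (rule prob_space_bernoulli_product)

lemma space_bernoulli_product [simp]: "space (bernoulli_product p) = UNIV"
  by (simp add: bernoulli_product_def space_PiM)

lemma measurable_bernoulli_component [measurable]:
  "Measurable.pred (bernoulli_product p) (\<lambda>\<omega>. \<omega> x)"
proof -
  have "(\<lambda>\<omega>. \<omega> x) \<in> measurable (bernoulli_product p) (measure_pmf (bernoulli_pmf p))"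
    unfolding bernoulli_product_def by (rule measurable_component_singleton) simp
  then show ?thesis by simp
qed

lemma measurable_into_bernoulli_product:
  assumes "\<And>x. Measurable.pred M (\<lambda>\<omega>. f \<omega> x)"
  shows "f \<in> measurable M (bernoulli_product p)"
  unfolding bernoulli_product_def
  by (rule measurable_PiM_single') (use assms in auto)

lemma measurable_boot_step_funpow [measurable]:
  "Measurable.pred (bernoulli_product p) (\<lambda>\<omega>. (boot_step ^^ n) \<omega> x)"
proof (induction n arbitrary: x)
  case (Suc n)
  note [measurable] = Suc.IH
  show ?case by (cases x) (simp add: boot_step_iff)
qed simp

lemma measurable_bootstrap [measurable]:
  "Measurable.pred (bernoulli_product p) (\<lambda>\<omega>. bootstrap n \<omega> x)"
  by (cases n) simp_all

text \<open>A connection is a path of some length, and there are countably many sites to choose its steps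
  from.\<close>

lemma measurable_mem_open_cluster [measurable]:
  "Measurable.pred (bernoulli_product p) (\<lambda>\<omega>. y \<in> open_cluster (bootstrap n \<omega>) x)"
proof -
  define R where "R = (\<lambda>\<omega> u v. star_nbr u v \<and> bootstrap n \<omega> u \<and> bootstrap n \<omega> v)"
  have [measurable]: "Measurable.pred (bernoulli_product p) (\<lambda>\<omega>. R \<omega> u v)" for u v
    unfolding R_def by measurable
  have [measurable]: "Measurable.pred (bernoulli_product p) (\<lambda>\<omega>. (R \<omega> ^^ k) x y)" for k y
  proof (induction k arbitrary: y)
    case (Suc k)
    note [measurable] = Suc.IH
    show ?case unfolding relpowp.simps relcompp_apply by measurable
  qed simp
  have "y \<in> open_cluster (bootstrap n \<omega>) x \<longleftrightarrow> bootstrap n \<omega> x \<and> (\<exists>k. (R \<omega> ^^ k) x y)" for \<omega>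
    by (simp only: open_cluster_def R_def mem_Collect_eq rtranclp_power)
  then show ?thesis by simp
qed

lemma measurable_infinite_open_cluster [measurable]:
  "Measurable.pred (bernoulli_product p) (\<lambda>\<omega>. infinite (open_cluster (bootstrap n \<omega>) x))"
proof -
  have "infinite A \<longleftrightarrow> (\<forall>k. \<exists>y. y \<in> A \<and> k < to_nat y)" for A :: "site set"
  proof -
    have "infinite A \<longleftrightarrow> infinite (to_nat ` A)"
      by (simp add: finite_image_iff inj_on_def)
    also have "\<dots> \<longleftrightarrow> (\<forall>k. \<exists>y. y \<in> A \<and> k < to_nat y)"
      unfolding infinite_nat_iff_unbounded by blast
    finally show ?thesis .
  qed
  then show ?thesis by simp
qed

lemma measurable_force_open [measurable]:
  "(\<lambda>\<omega>. force_open x \<omega>) \<in> measurable (bernoulli_product p) (bernoulli_product p)"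
  by (rule measurable_into_bernoulli_product) (simp add: fun_upd_apply)

text \<open>The event that \<open>A\<close> holds after opening \<open>x\<close> depends only on the other sites, hence is
  independent of the state of \<open>x\<close>; and when \<open>x\<close> is open, it is the event \<open>A\<close>.\<close>

lemma prob_force_open_le:
  assumes p: "0 \<le> p" "p \<le> 1" and A: "Measurable.pred (bernoulli_product p) A"
  shows "p * \<P>(\<omega> in bernoulli_product p. A (force_open x \<omega>)) \<le> \<P>(\<omega> in bernoulli_product p. A \<omega>)"
proof -
  let ?M = "bernoulli_product p" and ?B = "measure_pmf (bernoulli_pmf p)"
  let ?N = "\<Pi>\<^sub>M y\<in>UNIV - {x}. ?B"
  let ?f = "\<lambda>(b, X). fun_upd X x b"
  have ins: "insert x (UNIV - {x}) = UNIV" by auto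
  have M: "?M = distr (?B \<Otimes>\<^sub>M ?N) ?M ?f"
    using distr_pair_PiM_eq_PiM[of "UNIV - {x}" "\<lambda>_. ?B" x]
    by (simp add: ins bernoulli_product_def prob_space_measure_pmf)
  interpret N: prob_space ?N by (intro prob_space_PiM prob_space_measure_pmf)
  have comp: "Measurable.pred ?N (\<lambda>X. X z)" if "z \<noteq> x" for z
    using measurable_component_singleton[of z "UNIV - {x}" "\<lambda>_. ?B"] that by simp
  have f: "?f \<in> measurable (?B \<Otimes>\<^sub>M ?N) ?M"
  proof (rule measurable_into_bernoulli_product)
    fix z
    show "Measurable.pred (?B \<Otimes>\<^sub>M ?N) (\<lambda>q. ?f q z)"
    proof (cases "z = x")
      case True
      have "fst \<in> measurable (?B \<Otimes>\<^sub>M ?N) ?B" by (rule measurable_fst)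
      then show ?thesis using True by (simp add: case_prod_beta)
    next
      case False
      from measurable_compose[OF measurable_snd comp[OF False]] show ?thesis
        using False by (simp add: case_prod_beta)
    qed
  qed
  define C where "C = {X \<in> space ?N. A (force_open x X)}"
  have "(\<lambda>X. force_open x X) \<in> measurable ?N ?M"
    by (rule measurable_into_bernoulli_product) (use comp in \<open>auto simp: fun_upd_apply\<close>)
  from measurable_compose[OF this A] have C: "C \<in> sets ?N"
    by (simp add: C_def pred_def)
  have A': "Measurable.pred ?M (\<lambda>\<omega>. A (force_open x \<omega>))"
    by (rule measurable_compose[OF measurable_force_open A])
  \<comment> \<open>Independence: as \<open>C\<close> is the event on the sites other than \<open>x\<close>, the event splits as
    the rectangle \<open>S \<times> C\<close>. Below, \<open>S\<close> is first everything, then \<open>{True}\<close>.\<close>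
  have eq: "measure ?M {\<omega>. A (force_open x \<omega>) \<and> \<omega> x \<in> S} = measure ?B S * measure ?N C" for S
  proof -
    let ?D = "{\<omega>. A (force_open x \<omega>) \<and> \<omega> x \<in> S}"
    have "Measurable.pred ?M (\<lambda>\<omega>. \<omega> x \<in> S)"
      by (rule measurable_compose[OF measurable_bernoulli_component]) simp
    with A' have "{\<omega>. A (force_open x \<omega>)} \<inter> {\<omega>. \<omega> x \<in> S} \<in> sets ?M"
      by (intro sets.Int) (simp_all add: pred_def)
    then have D: "?D \<in> sets ?M" by (simp add: Collect_conj_eq)
    have "measure ?M ?D = measure (distr (?B \<Otimes>\<^sub>M ?N) ?M ?f) ?D"
      using M by simp
    also have "\<dots> = measure (?B \<Otimes>\<^sub>M ?N) (?f -` ?D \<inter> space (?B \<Otimes>\<^sub>M ?N))"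
      using f D by (rule measure_distr)
    also have "?f -` ?D \<inter> space (?B \<Otimes>\<^sub>M ?N) = S \<times> C"
      by (auto simp: C_def space_pair_measure)
    also have "measure (?B \<Otimes>\<^sub>M ?N) (S \<times> C) = measure ?B S * measure ?N C"
      using C by (simp add: measure_def N.emeasure_pair_measure_Times enn2real_mult)
    finally show ?thesis .
  qed
  have "p * measure ?M {\<omega>. A (force_open x \<omega>)} = measure ?M {\<omega>. A (force_open x \<omega>) \<and> \<omega> x}"
    using eq[of UNIV] eq[of "{True}"] p by (simp add: measure_pmf_single)
  also have "\<dots> \<le> measure ?M {\<omega>. A \<omega>}"
    using A by (intro bernoulli_product.finite_measure_mono) (auto simp: fun_upd_idem pred_def)
  finally show ?thesis by simp
qed

lemma distr_bernoulli_product_shift: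
  "distr (bernoulli_product p) (bernoulli_product p) (\<lambda>\<omega> z. \<omega> (z + y)) = bernoulli_product p"
  unfolding bernoulli_product_def
  using distr_PiM_reindex[of UNIV "\<lambda>_. measure_pmf (bernoulli_pmf p)" "\<lambda>z. z + y" UNIV]
  by (simp add: prob_space_measure_pmf restrict_def)

lemma infinite_open_cluster_shift:
  assumes "infinite (open_cluster \<omega> y)"
  shows "infinite (open_cluster (\<lambda>z. \<omega> (z + y)) 0)"
proof -
  have "linked (\<lambda>z. \<omega> (z + y)) (u - y) (v - y)" if "linked \<omega> u v" for u v
    using that
  proof (induction rule: rtranclp_induct)
    case (step v v')
    have "star_nbr (v - y) (v' - y)"
      using step.hyps by (cases v; cases v'; cases y) (simp add: star_nbr_iff)
    with step.hyps
    have "star_nbr (v - y) (v' - y) \<and> \<omega> (v - y + y) \<and> \<omega> (v' - y + y)" by simp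
    with step.IH show ?case by (rule rtranclp.rtrancl_into_rtrancl)
  qed (rule rtranclp.rtrancl_refl)
  from this[of y]
  have "(\<lambda>v. v - y) ` open_cluster \<omega> y \<subseteq> open_cluster (\<lambda>z. \<omega> (z + y)) 0"
    unfolding image_subset_iff by (simp add: mem_open_cluster)
  moreover have "infinite ((\<lambda>v. v - y) ` open_cluster \<omega> y)"
    using assms by (simp add: finite_image_iff)
  ultimately show ?thesis using finite_subset by blast
qed

lemma prob_infinite_open_cluster_le:
  "\<P>(\<omega> in bernoulli_product p. infinite (open_cluster \<omega> y)) \<le> theta p 0"
proof -
  let ?M = "bernoulli_product p" and ?T = "\<lambda>(\<omega> :: config) z. \<omega> (z + y)"
  let ?I = "{\<omega>. infinite (open_cluster \<omega> 0)}"
  have T: "?T \<in> measurable ?M ?M"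
    by (rule measurable_into_bernoulli_product) simp
  have I: "?I \<in> sets ?M"
    using measurable_infinite_open_cluster[of 0 0 p] by (simp add: pred_def)
  have "measure ?M {\<omega>. infinite (open_cluster \<omega> y)} \<le> measure ?M (?T -` ?I \<inter> space ?M)"
    using measurable_sets[OF T I]
    by (intro bernoulli_product.finite_measure_mono) (auto dest: infinite_open_cluster_shift)
  also have "\<dots> = measure (distr ?M ?M ?T) ?I"
    using T I by (simp add: measure_distr)
  also have "\<dots> = theta p 0"
    by (simp add: distr_bernoulli_product_shift theta_def)
  finally show ?thesis by simp
qed

section \<open>Comparison of the percolation quantities\<close>

lemma theta_bootstrap_ge: "theta p 0 \<le> theta p n"
  unfolding theta_def
  by (intro bernoulli_product.finite_measure_mono)
    (use measurable_infinite_open_cluster[of n 0 p] in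
      \<open>auto simp: pred_def dest: finite_subset[OF open_cluster_mono[OF bootstrap_increasing]]\<close>)

lemma tau_bootstrap_ge: "tau p 0 x \<le> tau p n x"
  unfolding tau_def
  by (intro bernoulli_product.finite_measure_mono)
    (use measurable_mem_open_cluster[of x n 0 p] in
      \<open>auto simp: pred_def dest: open_cluster_mono[OF bootstrap_increasing, THEN subsetD]\<close>)

text \<open>Union bound over the square of the origin; each of the four sites has the same probability of
  lying in an infinite initial cluster.\<close>

lemma theta_bootstrap_le: "theta p n \<le> 4 * theta p 0"
proof -
  let ?M = "bernoulli_product p" and ?S = "{(0, 0), (1, 0), (0, 1), (1, 1)} :: site set"
  let ?I = "\<lambda>y. {\<omega>. infinite (open_cluster \<omega> y)}"
  have I [measurable]: "?I y \<in> sets ?M" for y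
    using measurable_infinite_open_cluster[of 0 y p] by (simp add: pred_def)
  have "theta p n \<le> measure ?M (\<Union>y\<in>?S. ?I y)"
    unfolding theta_def
  proof (rule bernoulli_product.finite_measure_mono)
    show "{\<omega> \<in> space ?M. infinite (open_cluster (bootstrap n \<omega>) 0)} \<subseteq> (\<Union>y\<in>?S. ?I y)"
    proof
      fix \<omega> assume "\<omega> \<in> {\<omega> \<in> space ?M. infinite (open_cluster (bootstrap n \<omega>) 0)}"
      then have "infinite (open_cluster (bootstrap n \<omega>) (0, 0))" by (simp add: zero_prod_def)
      from infinite_open_cluster_bootstrap[OF this] show "\<omega> \<in> (\<Union>y\<in>?S. ?I y)" by simp
    qed
    show "(\<Union>y\<in>?S. ?I y) \<in> sets ?M" by (intro sets.finite_UN I) simp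
  qed
  also have "\<dots> \<le> (\<Sum>y\<in>?S. measure ?M (?I y))"
    by (intro bernoulli_product.finite_measure_subadditive_finite) auto
  also have "\<dots> \<le> (\<Sum>y\<in>?S. theta p 0)"
    using prob_infinite_open_cluster_le[of p] by (intro sum_mono) simp
  also have "\<dots> = 4 * theta p 0" by simp
  finally show ?thesis .
qed

lemma tau_bootstrap_le:
  assumes p: "0 < p" "p \<le> 1"
  shows "tau p n x \<le> p powr (- 2) * tau p 0 x"
proof -
  let ?M = "bernoulli_product p" and ?A = "\<lambda>\<omega>. x \<in> open_cluster \<omega> 0"
  have A: "Measurable.pred ?M ?A"
    using measurable_mem_open_cluster[of x 0 0 p] by simp
  have A': "Measurable.pred ?M (\<lambda>\<omega>. ?A (force_open x \<omega>))"
    by (rule measurable_compose[OF measurable_force_open A])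
  have A'': "Measurable.pred ?M (\<lambda>\<omega>. ?A (force_open x (force_open 0 \<omega>)))"
    by (rule measurable_compose[OF measurable_force_open A'])
  have "p\<^sup>2 * tau p n x \<le> p\<^sup>2 * \<P>(\<omega> in ?M. ?A (force_open x (force_open 0 \<omega>)))"
    unfolding tau_def
    by (intro mult_left_mono bernoulli_product.finite_measure_mono)
      (use A'' in \<open>auto simp: pred_def intro: open_cluster_bootstrap_force_open\<close>)
  also have "\<dots> \<le> p * \<P>(\<omega> in ?M. ?A (force_open x \<omega>))"
    using prob_force_open_le[OF _ _ A', of 0] p
    by (simp add: power2_eq_square mult.assoc mult_left_mono)
  also have "\<dots> \<le> tau p 0 x"
    using prob_force_open_le[OF _ _ A, of x] p by (simp add: tau_def)
  finally show ?thesis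
    using p by (simp add: powr_minus powr_numeral divide_simps mult.commute)
qed

text \<open>The bounds on the connectivity function put the difference of the decay rates between 0 and
  \<open>- 2 * ln p / site_norm x\<close>.\<close>

lemma decay_rate_bootstrap_tendsto_iff:
  assumes p: "0 < p" "p \<le> 1"
  shows "(decay_rate p n \<longlongrightarrow> L) sites_at_infinity \<longleftrightarrow> (decay_rate p 0 \<longlongrightarrow> L) sites_at_infinity"
proof -
  have norm: "filterlim site_norm at_top sites_at_infinity"
    by (simp add: sites_at_infinity_def filterlim_filtercomap)
  have diff: "0 \<le> decay_rate p 0 x - decay_rate p n x \<and>
      decay_rate p 0 x - decay_rate p n x \<le> - 2 * ln p / site_norm x" for x
  proof (cases "tau p 0 x = 0")
    \<comment> \<open>Both connectivities then vanish, and \<open>ln 0 = 0\<close> makes both decay rates 0.\<close>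
    case True
    then have "tau p n x = 0"
      using tau_bootstrap_le[OF p, of n x] by (simp add: tau_def measure_le_0_iff)
    then show ?thesis
      using p True by (simp add: decay_rate_def site_norm_def divide_nonpos_nonneg)
  next
    case False
    then have t0: "0 < tau p 0 x" by (simp add: tau_def zero_less_measure_iff)
    then have tn: "0 < tau p n x" using tau_bootstrap_ge[of p x n] by simp
    have "ln (tau p n x) \<le> ln (p powr (- 2) * tau p 0 x)"
      using tau_bootstrap_le[OF p] tn t0 p by (subst ln_le_cancel_iff) auto
    also have "\<dots> = - 2 * ln p + ln (tau p 0 x)"
      using t0 p by (simp add: ln_mult ln_powr)
    finally have "ln (tau p n x) - ln (tau p 0 x) \<le> - 2 * ln p" by simp
    moreover have "0 \<le> ln (tau p n x) - ln (tau p 0 x)"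
      using t0 tn tau_bootstrap_ge[of p x n] by simp
    moreover have "decay_rate p 0 x - decay_rate p n x =
        (ln (tau p n x) - ln (tau p 0 x)) / site_norm x"
      by (simp add: decay_rate_def diff_divide_distrib)
    moreover have "0 \<le> site_norm x" by (simp add: site_norm_def)
    ultimately show ?thesis
      using divide_right_mono[of "ln (tau p n x) - ln (tau p 0 x)" "- 2 * ln p" "site_norm x"]
      by simp
  qed
  have "((\<lambda>x. - 2 * ln p / site_norm x) \<longlongrightarrow> 0) sites_at_infinity"
    by (rule real_tendsto_divide_at_top[OF tendsto_const norm])
  from tendsto_sandwich[OF _ _ tendsto_const this]
  have "((\<lambda>x. decay_rate p 0 x - decay_rate p n x) \<longlongrightarrow> 0) sites_at_infinity"
    using diff by simp
  then show ?thesis by (intro iffI) (rule Lim_transform, assumption+, rule Lim_transform2)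
qed

lemma theta_0_0: "theta 0 0 = 0"
proof -
  have "theta 0 0 \<le> measure (bernoulli_product 0) {\<omega>. \<omega> 0}"
    unfolding theta_def
    by (intro bernoulli_product.finite_measure_mono)
      (auto simp: open_cluster_def measurable_bernoulli_component[unfolded pred_def, simplified])
  also have "\<dots> = 0"
  proof -
    have "measure (bernoulli_product 0) {\<omega>. \<omega> 0} =
      measure (distr (bernoulli_product 0) (measure_pmf (bernoulli_pmf 0)) (\<lambda>\<omega>. \<omega> 0)) {True}"
      by (subst measure_distr) (auto simp: vimage_def)
    also have "\<dots> = measure (measure_pmf (bernoulli_pmf 0)) {True}"
      unfolding bernoulli_product_def
      by (subst distr_PiM_component) (auto simp: prob_space_measure_pmf)
    finally show ?thesis by (simp add: measure_pmf_single)
  qed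
  finally show ?thesis by (simp add: theta_def measure_le_0_iff)
qed

text \<open>The supremum is over a nonempty subset of the unit interval: at \<open>p = 0\<close> almost surely no
  site is open. Hence every positive \<open>p\<close> up to \<open>pc_star\<close> is a probability.\<close>

lemma pc_star_le_1: "pc_star \<le> 1"
proof -
  have "{p \<in> {0..1}. theta p 0 = 0} \<noteq> {}"
  proof
    assume "{p \<in> {0..1}. theta p 0 = 0} = {}"
    moreover have "0 \<in> {p \<in> {0..1}. theta p 0 = 0}" by (simp add: theta_0_0)
    ultimately show False by blast
  qed
  then show ?thesis unfolding pc_star_def by (rule cSup_least) simp
qed

theorem theorem4:
  "\<exists>c1 c2 :: real. 0 < c1 \<and> 0 < c2 \<and>
    (\<forall>n :: enat. 1 \<le> n \<longrightarrow>
      (\<forall>p \<in> {pc_star<..1}. theta p 0 \<le> theta p n \<and> theta p n \<le> c1 * theta p 0) \<and>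
      (\<forall>p \<in> {0<..pc_star}. \<forall>x. tau p 0 x \<le> tau p n x \<and> tau p n x \<le> p powr (- c2) * tau p 0 x) \<and>
      (\<forall>p \<in> {0<..pc_star}. corr_length_exists p 0 \<longrightarrow>
         corr_length_exists p n \<and> corr_length p n = corr_length p 0))"
proof (rule exI[of _ 4], rule exI[of _ 2], intro conjI allI impI ballI)
  fix n :: enat and p :: real
  assume p: "p \<in> {0<..pc_star}"
  then have p': "0 < p" "p \<le> 1" using pc_star_le_1 by auto
  show "tau p 0 x \<le> tau p n x" for x by (rule tau_bootstrap_ge)
  show "tau p n x \<le> p powr (- 2) * tau p 0 x" for x by (rule tau_bootstrap_le[OF p'])
  assume "corr_length_exists p 0"
  then show "corr_length_exists p n"
    unfolding corr_length_exists_def decay_rate_bootstrap_tendsto_iff[OF p', of n] .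
  show "corr_length p n = corr_length p 0"
    unfolding corr_length_def t2_space_class.Lim_def decay_rate_bootstrap_tendsto_iff[OF p', of n] ..
qed (simp_all add: theta_bootstrap_ge theta_bootstrap_le)

end
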